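(* For all integers $n\ge 1$ and $k\ge 1$, $$B_{n,k}=\sum_{j=0}^{n-1}\left(B_{j,k}\,C_{n-j-1}+C_{j}\,B_{n-j-1,k-1}-B_{j,k}\,B_{n-j-1,k-1}\right),$$ where $B_{n,k}$ is the number of Dyck paths of order $n$ which hit or cross the line $y=x+k$ and $C_n$ is the $n$-th Catalan number.
   Context: A Dyck path of order $n\ge 0$ is a lattice path in the plane from $(0,0)$ to $(n,n)$ consisting of $2n$ unit steps, each going either up (adding $(0,1)$) or to the right (adding $(1,0)$), that never goes below the diagonal $y=x$ (touching the diagonal is allowed). The number of Dyck paths of order $n$ is the Catalan number $C_n=\frac{1}{n+1}\binom{2n}{n}$ (so $C_0=1$). For integers $n,k\ge 0$, $B_{n,k}$ denotes the number of Dyck paths of order $n$ which hit or cross the line $y=x+k$, i.e. which visit at least one lattice point $(x,y)$ with $y-x\ge k$. In particular $B_{n,0}=C_n$ for $n\ge 0$, and $B_{n,k}=0$ whenever $k>n$ (so $B_{0,k}=0$ for $k\ge 1$). Equivalently, for $n,k\ge 1$, $B_{n,k}$ is the number of sequences $a_1,\dots,a_{2n}$ of nonnegative integers with $a_1=1$, $a_{2n}=0$, $|a_i-a_{i+1}|=1$ for $1\le i<2n$, in which the value $k$ occurs at least once. *)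

theory Defs
  imports Complex_Main
begin

datatype step = Up | Right

text \<open>A lattice path starting at the origin is represented by its list of steps; \<open>endpoint w\<close> is
  the pair \<open>(x, y)\<close> reached after all the steps of \<open>w\<close>.\<close>

definition endpoint :: "step list \<Rightarrow> nat \<times> nat" where
  "endpoint w = (count_list w Right, count_list w Up)"

definition visited :: "step list \<Rightarrow> (nat \<times> nat) set" where
  "visited w = {endpoint (take i w) | i. i \<le> length w}"

definition dyck_path :: "nat \<Rightarrow> step list \<Rightarrow> bool" where
  "dyck_path n w \<longleftrightarrow>
     length w = 2 * n \<and> endpoint w = (n, n) \<and> (\<forall>(x, y) \<in> visited w. x \<le> y)"

text \<open>A path hits or crosses the line \<open>y = x + k\<close> if it visits a lattice point with \<open>y - x \<ge> k\<close>;
  the inequality is written additively to avoid truncated subtraction.\<close>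

definition reaches_line :: "nat \<Rightarrow> step list \<Rightarrow> bool" where
  "reaches_line k w \<longleftrightarrow> (\<exists>(x, y) \<in> visited w. x + k \<le> y)"

definition B :: "nat \<Rightarrow> nat \<Rightarrow> nat" where
  "B n k = card {w. dyck_path n w \<and> reaches_line k w}"

definition catalan :: "nat \<Rightarrow> nat" where
  "catalan n = ((2 * n) choose n) div (n + 1)"

text \<open>The division in the definition of \<open>catalan\<close> is exact, and the set counted by \<open>B\<close> is finite.\<close>

lemma catalan_exact: "(n + 1) * catalan n = (2 * n) choose n"
proof -
  have "(n + 1) * ((2 * n) choose (n + 1)) = n * ((2 * n) choose n)"
    using binomial_absorb_comp[of "2 * n" n] binomial_absorption[of n "2 * n"] 
    by (cases "n = 0") (auto simp: algebra_simps)
  then have "(n + 1) dvd n * ((2 * n) choose n)"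
    by (metis dvd_triv_left)
  moreover have "coprime (n + 1) n"
    by simp
  ultimately have "(n + 1) dvd ((2 * n) choose n)"
    by (simp add: coprime_dvd_mult_right_iff)
  then show ?thesis
    unfolding catalan_def by (rule dvd_mult_div_cancel)
qed

lemma finite_dyck_paths: "finite {w. dyck_path n w \<and> reaches_line k w}"
proof (rule finite_subset)
  have "set w \<subseteq> {Up, Right}" for w
    using step.exhaust by blast
  then show "{w. dyck_path n w \<and> reaches_line k w} \<subseteq>
      {w. set w \<subseteq> {Up, Right} \<and> length w = 2 * n}"
    by (auto simp: dyck_path_def)
  show "finite {w :: step list. set w \<subseteq> {Up, Right} \<and> length w = 2 * n}"
    by (rule finite_lists_length_eq) simp
qed

end

theory Submission
  imports Defs "HOL-Library.Sublist"
begin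

text \<open>
  A Dyck path of order \<open>n \<ge> 1\<close> starts with an up step, and it falls back to the diagonal for a
  first time. Hence it is \<open>Up # a @ Right # b\<close> for unique Dyck paths \<open>a\<close> and \<open>b\<close>, whose orders add
  up to \<open>n - 1\<close> (\<open>bij_betw_first_return\<close>). The part \<open>a\<close> is traversed one unit above the diagonal
  and the part \<open>b\<close> at its original height. So for \<open>k \<ge> 1\<close> the whole path reaches the line
  \<open>y = x + k\<close> iff \<open>a\<close> reaches \<open>y = x + (k - 1)\<close> or \<open>b\<close> reaches \<open>y = x + k\<close>
  (\<open>reaches_line_first_return\<close>). For \<open>b\<close> of order \<open>j\<close>, inclusion and exclusion over this
  disjunction gives the \<open>j\<close>-th summand, provided that the number of all Dyck paths of order \<open>n\<close>
  is \<open>catalan n\<close>.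

  As \<open>catalan\<close> stands for a quotient of a binomial coefficient, that last fact needs a proof of
  its own. It is a special case of the ballot theorem: removing the last step shows that the numbers
  of paths from the origin to \<open>(x, y)\<close> that stay weakly above the diagonal satisfy Pascal's
  recurrence, whose solution with the right boundary values is a difference of two binomial
  coefficients (\<open>card_ballot_paths\<close>).
\<close>

section \<open>Heights of lattice paths\<close>

definition height :: "step list \<Rightarrow> int" where
  "height w = int (count_list w Up) - int (count_list w Right)"

definition above_diagonal :: "step list \<Rightarrow> bool" where
  "above_diagonal w \<longleftrightarrow> (\<forall>p. prefix p w \<longrightarrow> height p \<ge> 0)"

text \<open>The level is an integer, so that it can be shifted freely when a first part of the path is
  split off.\<close>

definition hits :: "int \<Rightarrow> step list \<Rightarrow> bool" where
  "hits k w \<longleftrightarrow> (\<exists>p. prefix p w \<and> height p \<ge> k)"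

lemma height_simps [simp]:
  "height [] = 0"
  "height (Up # w) = height w + 1"
  "height (Right # w) = height w - 1"
  "height (v @ w) = height v + height w"
  by (simp_all add: height_def)

lemma above_diagonal_snoc:
  "above_diagonal (w @ [s]) \<longleftrightarrow> above_diagonal w \<and> height (w @ [s]) \<ge> 0"
  by (auto simp: above_diagonal_def)

lemma above_diagonal_height: "above_diagonal w \<Longrightarrow> height w \<ge> 0"
  by (auto simp: above_diagonal_def)

lemma hits_append: "hits k (v @ w) \<longleftrightarrow> hits k v \<or> hits (k - height v) w"
  by (auto simp: hits_def prefix_append algebra_simps)

lemma hits_Up: "hits k (Up # w) \<longleftrightarrow> k \<le> 0 \<or> hits (k - 1) w"
  by (auto simp: hits_def prefix_Cons algebra_simps)

lemma hits_Right: "hits k (Right # w) \<longleftrightarrow> k \<le> 0 \<or> hits (k + 1) w"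
proof -
  have "prefix p [Right] \<longleftrightarrow> p = [] \<or> p = [Right]" for p
    by (auto simp: prefix_Cons)
  then have "hits k [Right] \<longleftrightarrow> k \<le> 0 \<or> k \<le> - 1"
    by (simp add: hits_def conj_disj_distribR ex_disj_distrib)
  then have "hits k [Right] \<longleftrightarrow> k \<le> 0"
    by linarith
  then show ?thesis
    using hits_append[of k "[Right]" w] by simp
qed

lemma hits_nonpos: "k \<le> 0 \<Longrightarrow> hits k w"
  unfolding hits_def by (rule exI[of _ "[]"]) simp

lemma visited_conv_prefix: "visited w = endpoint ` {p. prefix p w}"
proof -
  have "{take i w | i. i \<le> length w} = {p. prefix p w}"
    by (auto simp: take_is_prefix) (metis append_eq_conv_conj prefix_def prefix_length_le)
  moreover have "visited w = endpoint ` {take i w | i. i \<le> length w}"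
    by (auto simp: visited_def)
  ultimately show ?thesis by simp
qed

lemma above_diagonal_iff_visited:
  "above_diagonal w \<longleftrightarrow> (\<forall>(x, y) \<in> visited w. x \<le> y)"
  by (auto simp: visited_conv_prefix above_diagonal_def endpoint_def height_def)

lemma reaches_line_iff_hits: "reaches_line k w \<longleftrightarrow> hits (int k) w"
proof -
  have "reaches_line k w \<longleftrightarrow> (\<exists>p. prefix p w \<and> (case endpoint p of (x, y) \<Rightarrow> x + k \<le> y))"
    by (simp add: reaches_line_def visited_conv_prefix)
  moreover have "(case endpoint p of (x, y) \<Rightarrow> x + k \<le> y) \<longleftrightarrow> int k \<le> height p" for p
    by (auto simp: endpoint_def height_def)
  ultimately show ?thesis
    by (simp add: hits_def)
qed

lemma length_conv_count_list: "length w = count_list w Up + count_list w Right"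
proof (induction w)
  case (Cons s w)
  then show ?case by (cases s) auto
qed simp

lemma dyck_path_iff:
  "dyck_path n w \<longleftrightarrow> length w = 2 * n \<and> height w = 0 \<and> above_diagonal w"
  using length_conv_count_list[of w]
  by (auto simp: dyck_path_def above_diagonal_iff_visited endpoint_def height_def)

lemma finite_dyck_path: "finite {w. dyck_path n w}"
proof -
  have "{w. dyck_path n w} = {w. dyck_path n w \<and> reaches_line 0 w}"
    by (auto simp: reaches_line_iff_hits hits_nonpos)
  then show ?thesis
    using finite_dyck_paths[of n 0] by simp
qed

section \<open>The number of Dyck paths\<close>

definition ballot_paths :: "nat \<Rightarrow> nat \<Rightarrow> step list set" where
  "ballot_paths x y = {w. endpoint w = (x, y) \<and> above_diagonal w}"

lemma finite_ballot_paths: "finite (ballot_paths x y)"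
proof (rule finite_subset)
  have "set w \<subseteq> {Up, Right}" for w
    using step.exhaust by blast
  then show "ballot_paths x y \<subseteq> {w. set w \<subseteq> {Up, Right} \<and> length w = x + y}"
    by (auto simp: ballot_paths_def endpoint_def length_conv_count_list)
  show "finite {w :: step list. set w \<subseteq> {Up, Right} \<and> length w = x + y}"
    by (rule finite_lists_length_eq) simp
qed

lemma ballot_paths_empty:
  assumes "y < x"
  shows "ballot_paths x y = {}"
  using assms above_diagonal_height
  by (force simp: ballot_paths_def endpoint_def height_def)

lemma ballot_paths_0_0: "ballot_paths 0 0 = {[]}"
proof -
  have "w = []" if "endpoint w = (0, 0)" for w
    using that length_conv_count_list[of w] by (simp add: endpoint_def)
  then show ?thesis
    by (auto simp: ballot_paths_def endpoint_def above_diagonal_def)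
qed

lemma ballot_paths_0_Suc: "ballot_paths 0 (Suc y) = (\<lambda>w. w @ [Up]) ` ballot_paths 0 y"
proof (intro equalityI subsetI)
  fix w assume w: "w \<in> ballot_paths 0 (Suc y)"
  then obtain v s where "w = v @ [s]"
    by (cases w rule: rev_cases) (auto simp: ballot_paths_def endpoint_def)
  with w show "w \<in> (\<lambda>w. w @ [Up]) ` ballot_paths 0 y"
    by (cases s) (auto simp: ballot_paths_def endpoint_def above_diagonal_snoc)
next
  fix w assume "w \<in> (\<lambda>w. w @ [Up]) ` ballot_paths 0 y"
  then show "w \<in> ballot_paths 0 (Suc y)"
    using above_diagonal_height
    by (fastforce simp: ballot_paths_def endpoint_def above_diagonal_snoc)
qed

lemma ballot_paths_Suc_Suc:
  assumes "x \<le> y"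
  shows "ballot_paths (Suc x) (Suc y) =
    (\<lambda>w. w @ [Right]) ` ballot_paths x (Suc y) \<union> (\<lambda>w. w @ [Up]) ` ballot_paths (Suc x) y"
    (is "?L = ?R")
proof (intro equalityI subsetI)
  fix w assume w: "w \<in> ?L"
  then obtain v s where "w = v @ [s]"
    by (cases w rule: rev_cases) (auto simp: ballot_paths_def endpoint_def)
  with w show "w \<in> ?R"
    by (cases s) (auto simp: ballot_paths_def endpoint_def above_diagonal_snoc)
next
  fix w assume "w \<in> ?R"
  then show "w \<in> ?L"
    using assms
    by (auto simp: ballot_paths_def endpoint_def above_diagonal_snoc height_def)
qed

text \<open>The second binomial coefficient is the number of bad paths, which Andre's reflection maps to
  the paths ending at \<open>(y + 1, x - 1)\<close>; written with \<open>Suc y\<close> it also makes sense for \<open>x = 0\<close>. The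
  range includes the endpoints \<open>(y + 1, y)\<close> just below the diagonal, where both sides vanish:
  they are the boundary values for the recurrence.\<close>

lemma card_ballot_paths:
  assumes "x \<le> Suc y"
  shows "int (card (ballot_paths x y)) = int ((x + y) choose x) - int ((x + y) choose Suc y)"
  using assms
proof (induction "x + y" arbitrary: x y rule: less_induct)
  case less
  have inj: "inj_on (\<lambda>w. w @ [s]) A" for s :: step and A
    by (simp add: inj_on_def)
  consider "x = Suc y" | "x = 0" "y = 0" | y' where "x = 0" "y = Suc y'"
    | x' y' where "x = Suc x'" "y = Suc y'" "x' \<le> y'"
    using less.prems by (cases x; cases y) (auto simp: le_Suc_eq)
  then show ?case
  proof cases
    case 1
    then show ?thesis
      by (simp add: ballot_paths_empty)
  next
    case 2
    then show ?thesis
      by (simp add: ballot_paths_0_0)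
  next
    case 3
    then show ?thesis
      using less.hyps[of 0 y'] by (simp add: ballot_paths_0_Suc card_image[OF inj])
  next
    case 4
    have "card (ballot_paths x y) = card (ballot_paths x' (Suc y')) + card (ballot_paths (Suc x') y')"
      unfolding 4(1,2) ballot_paths_Suc_Suc[OF 4(3)]
      by (subst card_Un_disjoint) (auto simp: finite_ballot_paths card_image[OF inj])
    moreover have "int (card (ballot_paths x' (Suc y'))) =
        int ((x' + Suc y') choose x') - int ((x' + Suc y') choose Suc (Suc y'))"
      by (rule less.hyps) (use 4 in auto)
    moreover have "int (card (ballot_paths (Suc x') y')) =
        int ((Suc x' + y') choose Suc x') - int ((Suc x' + y') choose Suc y')"
      by (rule less.hyps) (use 4 in auto)
    ultimately show ?thesis
      using 4 by simp
  qed
qed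

lemma card_dyck_path: "card {w. dyck_path n w} = catalan n"
proof -
  have "{w. dyck_path n w} = ballot_paths n n"
    using length_conv_count_list
    by (auto simp: dyck_path_def ballot_paths_def above_diagonal_iff_visited endpoint_def)
  then have "int (card {w. dyck_path n w}) = int ((2 * n) choose n) - int ((2 * n) choose Suc n)"
    using card_ballot_paths[of n n] by (simp add: mult_2)
  moreover have "Suc n * ((2 * n) choose Suc n) = n * ((2 * n) choose n)"
    using binomial_absorb_comp[of "2 * n" n] binomial_absorption[of n "2 * n"]
    by (cases "n = 0") (auto simp: algebra_simps)
  then have "int (Suc n) * int ((2 * n) choose Suc n) = int n * int ((2 * n) choose n)"
    by (metis of_nat_mult)
  ultimately have "int (Suc n) * int (card {w. dyck_path n w}) =
      int (Suc n) * int ((2 * n) choose n) - int n * int ((2 * n) choose n)"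
    by (simp only: right_diff_distrib)
  also have "\<dots> = int ((2 * n) choose n)"
    by (simp add: distrib_right)
  also have "\<dots> = int (Suc n) * int (catalan n)"
    using catalan_exact[of n] by (metis Suc_eq_plus1 of_nat_mult)
  finally show ?thesis
    by (metis mult_cancel_left of_nat_0_eq_iff of_nat_eq_iff nat.distinct(1))
qed

section \<open>Decomposition at the first return to the diagonal\<close>

text \<open>Heights change by one unit, so a path that leaves the region above the diagonal does so by a
  right step from height zero.\<close>

lemma first_crossing:
  assumes "\<not> above_diagonal w"
  shows "\<exists>a b. w = a @ Right # b \<and> above_diagonal a \<and> height a = 0"
  using assms
proof (induction w rule: rev_induct)
  case Nil
  then show ?case by (simp add: above_diagonal_def)
next
  case (snoc s w)
  show ?case
  proof (cases "above_diagonal w")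
    case True
    with snoc.prems above_diagonal_height[OF True] have "s = Right" "height w = 0"
      by (cases s; simp add: above_diagonal_snoc)+
    with True show ?thesis by blast
  next
    case False
    with snoc.IH show ?thesis by fastforce
  qed
qed

text \<open>If one crossing came earlier than the other, then the path up to the later one would already
  have been at height \<open>-1\<close>.\<close>

lemma first_crossing_unique:
  assumes "a @ Right # b = a' @ Right # b'"
    and a: "above_diagonal a" "height a = 0"
    and a': "above_diagonal a'" "height a' = 0"
  shows "a = a' \<and> b = b'"
proof -
  have no_extension: False
    if "d = c @ Right # u" "above_diagonal d" "height c = 0" for c d u
  proof -
    have "prefix (c @ [Right]) d"
      using that(1) by simp
    with that(2) have "height (c @ [Right]) \<ge> 0"
      unfolding above_diagonal_def by blast
    with that(3) show False by simp
  qed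
  from assms(1) obtain u where
    "a = a' @ u \<and> u @ Right # b = Right # b' \<or> a @ u = a' \<and> Right # b = u @ Right # b'"
    by (auto simp: append_eq_append_conv2)
  then have "u = []"
    using no_extension[of a a'] no_extension[of a' a] a a' by (cases u) auto
  with assms(1) \<open>_ \<or> _\<close> show ?thesis by auto
qed

lemma above_diagonal_first_return:
  assumes "height a = 0" "above_diagonal a" "above_diagonal b"
  shows "above_diagonal (Up # a @ Right # b)"
  using assms by (fastforce simp: above_diagonal_def prefix_Cons prefix_append)

text \<open>The index is the order of the last part of the path, matching the index of the sum in the
  recurrence.\<close>

lemma bij_betw_first_return:
  "bij_betw (\<lambda>(j, a, b). Up # a @ Right # b)
     (SIGMA j:{..n}. {a. dyck_path (n - j) a} \<times> {b. dyck_path j b})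
     {w. dyck_path (Suc n) w}"
  (is "bij_betw ?f ?S ?T")
proof (rule bij_betw_imageI)
  show "inj_on ?f ?S"
  proof (rule inj_onI, clarsimp)
    fix j a b j' a' b'
    assume d: "dyck_path (n - j) a" "dyck_path j b" "dyck_path (n - j') a'" "dyck_path j' b'"
      and eq: "a @ Right # b = a' @ Right # b'"
    then have "a = a' \<and> b = b'"
      using first_crossing_unique[OF eq] by (simp add: dyck_path_iff)
    with d show "j = j' \<and> a = a' \<and> b = b'"
      by (auto simp: dyck_path_iff)
  qed
  show "?f ` ?S = ?T"
  proof (intro equalityI subsetI)
    fix w assume "w \<in> ?f ` ?S"
    then obtain j a b where "j \<le> n" "dyck_path (n - j) a" "dyck_path j b" "w = Up # a @ Right # b"
      by auto
    then show "w \<in> ?T"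
      by (auto simp: dyck_path_iff above_diagonal_first_return)
  next
    fix w assume "w \<in> ?T"
    then have w: "length w = 2 * Suc n" "height w = 0" "above_diagonal w"
      by (auto simp: dyck_path_iff)
    then obtain s v where sv: "w = s # v"
      by (cases w) auto
    have "prefix [s] w"
      using sv by simp
    with w(3) have "height [s] \<ge> 0"
      unfolding above_diagonal_def by blast
    then have s: "s = Up"
      by (cases s) auto
    with sv w(2) have "height v = - 1"
      by simp
    then have "\<not> above_diagonal v"
      using above_diagonal_height[of v] by auto
    then obtain a b where ab: "v = a @ Right # b" "above_diagonal a" "height a = 0"
      using first_crossing by blast
    with \<open>height v = - 1\<close> have hb: "height b = 0"
      by simp
    have "height p \<ge> 0" if "prefix p b" for p
    proof -
      have "prefix (Up # a @ Right # p) w"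
        using that sv s ab(1) by (simp add: prefix_Cons)
      with w(3) have "height (Up # a @ Right # p) \<ge> 0"
        unfolding above_diagonal_def by blast
      with ab(3) show ?thesis by simp
    qed
    then have b: "above_diagonal b"
      by (simp add: above_diagonal_def)
    have even: "even (length u)" if "height u = 0" for u
      using that length_conv_count_list[of u] by (simp add: height_def)
    obtain i j where ij: "length a = 2 * i" "length b = 2 * j"
      using even[OF ab(3)] even[OF hb] by (auto elim!: evenE)
    with w(1) sv ab(1) have "n = i + j"
      by simp
    with ij ab b hb have "(j, a, b) \<in> ?S"
      by (simp add: dyck_path_iff)
    moreover have "w = ?f (j, a, b)"
      using sv s ab(1) by simp
    ultimately show "w \<in> ?f ` ?S"
      by (rule rev_image_eqI)
  qed
qed

text \<open>The origin is the only vertex that belongs neither to the raised copy of \<open>a\<close> nor to \<open>b\<close>, and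
  at height \<open>0 < k\<close> it does not count.\<close>

lemma reaches_line_first_return:
  assumes "height a = 0" and "k \<ge> 1"
  shows "reaches_line k (Up # a @ Right # b) \<longleftrightarrow> reaches_line (k - 1) a \<or> reaches_line k b"
proof -
  have "hits (int k) (Up # a @ Right # b) \<longleftrightarrow> hits (int k - 1) a \<or> hits (int k) b"
    using assms hits_nonpos[of "int k - 1" a]
    by (auto simp: hits_Up hits_append hits_Right)
  with assms show ?thesis
    by (simp add: reaches_line_iff_hits of_nat_diff)
qed

section \<open>The recurrence\<close>

lemma card_pairs_disj:
  assumes "finite A" "finite D"
  shows "int (card {(a, d) \<in> A \<times> D. P a \<or> Q d}) =
    int (card {d \<in> D. Q d}) * int (card A)
      + int (card D) * int (card {a \<in> A. P a})
      - int (card {d \<in> D. Q d}) * int (card {a \<in> A. P a})"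
proof -
  let ?X = "{a \<in> A. P a} \<times> D" and ?Y = "A \<times> {d \<in> D. Q d}"
  have "{(a, d) \<in> A \<times> D. P a \<or> Q d} = ?X \<union> ?Y"
    by auto
  moreover have "?X \<inter> ?Y = {a \<in> A. P a} \<times> {d \<in> D. Q d}"
    by auto
  moreover have "card ?X + card ?Y = card (?X \<union> ?Y) + card (?X \<inter> ?Y)"
    by (rule card_Un_Int) (use assms in auto)
  ultimately have "int (card {(a, d) \<in> A \<times> D. P a \<or> Q d}) =
      int (card ?X) + int (card ?Y) - int (card ({a \<in> A. P a} \<times> {d \<in> D. Q d}))"
    by simp
  then show ?thesis
    by (simp add: card_cartesian_product mult.commute)
qed

theorem theorem2p2:
  fixes n k :: nat
  assumes "n \<ge> 1" and "k \<ge> 1"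
  shows "int (B n k) =
    (\<Sum>j = 0..n - 1.
        int (B j k) * int (catalan (n - j - 1))
      + int (catalan j) * int (B (n - j - 1) (k - 1))
      - int (B j k) * int (B (n - j - 1) (k - 1)))"
proof -
  obtain m where n: "n = Suc m"
    using assms(1) by (cases n) auto
  define pairs where "pairs j =
    {(a, b) \<in> {a. dyck_path (m - j) a} \<times> {b. dyck_path j b}.
       reaches_line (k - 1) a \<or> reaches_line k b}" for j
  let ?f = "\<lambda>(j :: nat, a, b). Up # a @ Right # b"
  let ?S = "SIGMA j:{..m}. {a. dyck_path (m - j) a} \<times> {b. dyck_path j b}"
  have fin: "finite (pairs j)" for j
    by (rule finite_subset[of _ "{a. dyck_path (m - j) a} \<times> {b. dyck_path j b}"])
      (auto simp: pairs_def finite_dyck_path)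
  have sub: "(SIGMA j:{..m}. pairs j) \<subseteq> ?S"
    by (auto simp: pairs_def)
  have reach: "reaches_line k (?f t) \<longleftrightarrow> t \<in> (SIGMA j:{..m}. pairs j)" if "t \<in> ?S" for t
    using that assms(2)
    by (auto simp: pairs_def dyck_path_iff reaches_line_first_return)
  have image: "?f ` ?S = {w. dyck_path n w}"
    using bij_betw_first_return[of m] unfolding n by (rule bij_betw_imp_surj_on)
  have "{w. dyck_path n w \<and> reaches_line k w} = {w \<in> ?f ` ?S. reaches_line k w}"
    unfolding image by blast
  also have "\<dots> = ?f ` (SIGMA j:{..m}. pairs j)"
    using reach sub by blast
  finally have "B n k = card (?f ` (SIGMA j:{..m}. pairs j))"
    by (simp add: B_def)
  also have "\<dots> = card (SIGMA j:{..m}. pairs j)"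
    using bij_betw_imp_inj_on[OF bij_betw_first_return[of m]] sub
    by (intro card_image) (rule inj_on_subset)
  also have "\<dots> = (\<Sum>j\<le>m. card (pairs j))"
    using fin by simp
  finally have "int (B n k) = (\<Sum>j\<le>m. int (card (pairs j)))"
    by simp
  also have "\<dots> = (\<Sum>j\<le>m. int (B j k) * int (catalan (m - j))
      + int (catalan j) * int (B (m - j) (k - 1)) - int (B j k) * int (B (m - j) (k - 1)))"
  proof (rule sum.cong)
    fix j
    have "B i l = card {w \<in> {w. dyck_path i w}. reaches_line l w}" for i l
      by (simp add: B_def)
    then show "int (card (pairs j)) = int (B j k) * int (catalan (m - j))
      + int (catalan j) * int (B (m - j) (k - 1)) - int (B j k) * int (B (m - j) (k - 1))"
      unfolding pairs_def
      by (subst card_pairs_disj) (simp_all only: finite_dyck_path card_dyck_path)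
  qed simp
  finally show ?thesis
    by (simp add: n atLeast0AtMost)
qed

end
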